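(* Let $r\ge 2$ be an integer. There exists a constant $c_r>0$ depending only on $r$ such that every graph $G$ with $m$ edges satisfying $\lambda(G)^2 > (1-\frac{1}{r})\,2m$ contains a copy of the generalized book $B_{r,k}$ with $k \ge c_r\sqrt{m}$. Furthermore, there exist a constant $C_r$ and, for infinitely many $m$, graphs $G$ with $m$ edges and $\lambda(G)^2 > (1-\frac{1}{r})\,2m$ that contain no copy of $B_{r,k}$ with $k > C_r\sqrt{m}$.
   Context: All graphs are finite, simple and undirected; $\lambda(G)$ denotes the largest eigenvalue of the adjacency matrix of $G$. The generalized book $B_{r,k}=K_r\vee I_k$ is the graph obtained by joining every vertex of a clique $K_r$ to every vertex of an independent set $I_k$ of size $k$ (i.e. $k$ copies of $K_{r+1}$ sharing a common $K_r$). *)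

theory Defs
  imports Complex_Main "Jordan_Normal_Form.Spectral_Radius"
begin

text \<open>
  A finite simple undirected graph is given by its order \<open>n\<close> and its set of edges \<open>E\<close>; the
  vertices are the numbers below \<open>n\<close>, so every finite graph occurs up to isomorphism.
  The order is positive, as the graph on no vertices has no eigenvalue.
\<close>

definition simple_graph :: "nat \<Rightarrow> nat set set \<Rightarrow> bool" where
  "simple_graph n E \<longleftrightarrow> 0 < n \<and> (\<forall>e\<in>E. e \<subseteq> {..<n} \<and> card e = 2)"

definition adjacency_matrix :: "nat \<Rightarrow> nat set set \<Rightarrow> real mat" where
  "adjacency_matrix n E = mat n n (\<lambda>(i, j). if {i, j} \<in> E then 1 else 0)"

text \<open>The adjacency matrix is symmetric, so all its eigenvalues are real and the spectrum over
  the reals is the whole spectrum; it is finite and nonempty, hence the maximum is attained.\<close>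

definition largest_eigenvalue :: "nat \<Rightarrow> nat set set \<Rightarrow> real" where
  "largest_eigenvalue n E = Max (spectrum (adjacency_matrix n E))"

text \<open>The generalized book on \<open>r + k\<close> vertices: the clique is on the vertices below \<open>r\<close>, the
  independent set consists of the remaining \<open>k\<close> vertices.\<close>

definition book_edges :: "nat \<Rightarrow> nat \<Rightarrow> nat set set" where
  "book_edges r k =
     {{i, j} | i j. i < r \<and> j < r \<and> i \<noteq> j} \<union> {{i, j} | i j. i < r \<and> r \<le> j \<and> j < r + k}"

text \<open>A copy of the graph \<open>(p, F)\<close> in \<open>(n, E)\<close> is a subgraph, not necessarily induced.\<close>

definition contains_copy :: "nat \<Rightarrow> nat set set \<Rightarrow> nat \<Rightarrow> nat set set \<Rightarrow> bool" where
  "contains_copy n E p F \<longleftrightarrow>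
     (\<exists>f. inj_on f {..<p} \<and> f ` {..<p} \<subseteq> {..<n} \<and> (\<forall>e\<in>F. f ` e \<in> E))"

abbreviation contains_book :: "nat \<Rightarrow> nat set set \<Rightarrow> nat \<Rightarrow> nat \<Rightarrow> bool" where
  "contains_book n E r k \<equiv> contains_copy n E (r + k) (book_edges r k)"

end

theory Submission
  imports Defs "HOL-Analysis.Convex"
begin

text \<open>
  Let \<open>x\<close> be the entrywise absolute value of a unit eigenvector of \<open>\<lambda>\<close>, so that \<open>L = x\<^sup>T A x\<close> is at
  least \<open>\<bar>\<lambda>\<bar>\<close>, and put \<open>\<tau> = L / (2m)\<close>, which is at most \<open>1 / \<surd>(2m)\<close>. Cauchy--Schwarz would bound
  \<open>L\<^sup>2 / (2m)\<close> by the edge density of \<open>G\<close> in the vertex weights \<open>y = x\<^sup>2\<close>. Giving the edge \<open>ij\<close> only the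
  truncated weight \<open>h\<^sub>i\<^sub>j = max 0 (2 \<tau> x\<^sub>i x\<^sub>j - \<tau>\<^sup>2) \<le> y\<^sub>i y\<^sub>j\<close> still leaves a density above \<open>1 - 1/r\<close>.
  Discarding vertices of small \<open>h\<close>-degree keeps a constant proportion of the weight, and
  Motzkin--Straus yields an \<open>(r+1)\<close>-clique \<open>Q\<close> of positive \<open>h\<close> among the remaining vertices. The
  sum of \<open>h\<^sub>v\<^sub>j / y\<^sub>v\<close> over \<open>v \<in> Q\<close> and all \<open>j\<close> exceeds \<open>r - 1\<close> times the total weight by a constant
  factor, so the vertices adjacent to all but at most one vertex of \<open>Q\<close> account for a constant
  amount. The truncation prevents this amount from sitting on few heavy vertices: every vertex of
  \<open>Q\<close> except at most one has \<open>x\<^sub>v \<ge> \<surd>\<tau> / 2\<close>, whence \<open>h\<^sub>v\<^sub>j / y\<^sub>v \<le> 4 \<surd>\<tau> x\<^sub>j\<close>, and Cauchy--Schwarz gives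
  order \<open>1 / \<tau>\<close> such vertices. The pigeonhole principle selects the \<open>r\<close>-clique. Complete graphs show
  sharpness.
\<close>

section \<open>The Motzkin--Straus inequality\<close>

definition total_weight :: "('a \<Rightarrow> 'a \<Rightarrow> real) \<Rightarrow> 'a set \<Rightarrow> real" where
  "total_weight h U = (\<Sum>i\<in>U. \<Sum>j\<in>U. h i j)"

lemma total_weight_mono:
  assumes "\<And>i j. i \<in> U \<Longrightarrow> j \<in> U \<Longrightarrow> h i j \<le> h' i j"
  shows "total_weight h U \<le> total_weight h' U"
  unfolding total_weight_def using assms by (intro sum_mono)

lemma total_weight_remove:
  assumes "finite V" "v \<in> V" and sym: "\<And>i j. h i j = h j i" and "h v v = 0"
  shows "total_weight h V = total_weight h (V - {v}) + 2 * (\<Sum>j\<in>V. h v j)"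
proof -
  have row: "(\<Sum>j\<in>V. h i j) = h i v + (\<Sum>j\<in>V-{v}. h i j)" for i
    using assms(1,2) by (rule sum.remove)
  have "total_weight h V = (\<Sum>j\<in>V. h v j) + (\<Sum>i\<in>V-{v}. \<Sum>j\<in>V. h i j)"
    unfolding total_weight_def using assms(1,2) by (rule sum.remove)
  also have "(\<Sum>i\<in>V-{v}. \<Sum>j\<in>V. h i j) = (\<Sum>i\<in>V-{v}. h i v) + total_weight h (V - {v})"
    by (simp add: row sum.distrib total_weight_def)
  also have "(\<Sum>i\<in>V-{v}. h i v) = (\<Sum>j\<in>V. h v j)"
    using row[of v] \<open>h v v = 0\<close> sym by simp
  finally show ?thesis by simp
qed

text \<open>The sum ranges over ordered pairs, so this is twice the usual Lagrangian of a graph.\<close>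

definition lagrangian :: "('a \<Rightarrow> 'a \<Rightarrow> bool) \<Rightarrow> ('a \<Rightarrow> real) \<Rightarrow> 'a set \<Rightarrow> real" where
  "lagrangian adj y V = total_weight (\<lambda>i j. if adj i j then y i * y j else 0) V"

lemma lagrangian_cong:
  assumes "\<And>i. i \<in> V \<Longrightarrow> y i = z i"
  shows "lagrangian adj y V = lagrangian adj z V"
  unfolding lagrangian_def total_weight_def using assms by (intro sum.cong) auto

lemma lagrangian_nonneg:
  assumes "\<And>i. i \<in> V \<Longrightarrow> 0 \<le> y i"
  shows "0 \<le> lagrangian adj y V"
  unfolding lagrangian_def total_weight_def using assms by (intro sum_nonneg) auto

lemma lagrangian_squared_le:
  "(lagrangian adj x V)\<^sup>2 \<le> lagrangian adj (\<lambda>_. 1) V * (\<Sum>i\<in>V. (x i)\<^sup>2)\<^sup>2"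
proof -
  define edge where "edge = (\<lambda>(i, j). of_bool (adj i j) :: real)"
  define product where "product = (\<lambda>(i, j). x i * x j)"
  have "(lagrangian adj x V)\<^sup>2 = (\<Sum>p\<in>V\<times>V. edge p * product p)\<^sup>2"
    unfolding lagrangian_def total_weight_def sum.cartesian_product edge_def product_def
    by (intro arg_cong[of _ _ "\<lambda>t. t\<^sup>2"] sum.cong) auto
  also have "\<dots> \<le> (\<Sum>p\<in>V\<times>V. (edge p)\<^sup>2) * (\<Sum>p\<in>V\<times>V. (product p)\<^sup>2)"
    by (rule Cauchy_Schwarz_ineq_sum)
  also have "(\<Sum>p\<in>V\<times>V. (edge p)\<^sup>2) = lagrangian adj (\<lambda>_. 1) V"
    unfolding lagrangian_def total_weight_def sum.cartesian_product edge_def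
    by (intro sum.cong) auto
  also have "(\<Sum>p\<in>V\<times>V. (product p)\<^sup>2) = (\<Sum>i\<in>V. (x i)\<^sup>2)\<^sup>2"
    unfolding power2_eq_square[of "\<Sum>i\<in>V. (x i)\<^sup>2"] sum_product sum.cartesian_product product_def
    by (intro sum.cong) (auto simp: power_mult_distrib)
  finally show ?thesis .
qed

lemma lagrangian_remove:
  assumes "finite V" "v \<in> V" "symp adj" "irreflp adj"
  shows "lagrangian adj y V = lagrangian adj y (V - {v}) + 2 * y v * sum y {j \<in> V. adj v j}"
proof -
  have "lagrangian adj y V =
      lagrangian adj y (V - {v}) + 2 * (\<Sum>j\<in>V. if adj v j then y v * y j else 0)"
    unfolding lagrangian_def using assms
    by (intro total_weight_remove) (auto simp: irreflp_def dest: sympD)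
  also have "(\<Sum>j\<in>V. if adj v j then y v * y j else 0) = y v * sum y {j \<in> V. adj v j}"
    using \<open>finite V\<close> by (simp add: sum_distrib_left flip: sum.inter_filter)
  finally show ?thesis by simp
qed

lemma sum_merge:
  fixes y :: "'a \<Rightarrow> 'b :: comm_monoid_add"
  assumes "finite V" "u \<in> V" "v \<in> V" "u \<noteq> v"
  shows "sum (y(v := y u + y v)) (V - {u}) = sum y V"
proof -
  have "sum (y(v := y u + y v)) (V - {u}) = y u + y v + sum y (V - {u} - {v})"
    using assms sum.remove[of "V - {u}" v "y(v := y u + y v)"] by simp
  also have "\<dots> = sum y V"
    using assms sum.remove[of V u y] sum.remove[of "V - {u}" v y] by (simp add: add.assoc)
  finally show ?thesis .
qed

lemma lagrangian_le_merge_nonadjacent: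
  assumes "finite V" "symp adj" "irreflp adj" and uv: "u \<in> V" "v \<in> V" "u \<noteq> v" "\<not> adj u v"
    and "0 \<le> y u" and degree_le: "sum y {j \<in> V. adj u j} \<le> sum y {j \<in> V. adj v j}"
  shows "lagrangian adj y V \<le> lagrangian adj (y(v := y u + y v)) (V - {u})"
proof -
  define z where "z = y(v := y u + y v)"
  have "\<not> adj v u" using uv \<open>symp adj\<close> by (auto dest: sympD)
  then have nbrs: "{j \<in> V - {u}. adj v j} = {j \<in> V. adj v j}" by auto
  have "sum z {j \<in> V. adj v j} = sum y {j \<in> V. adj v j}"
    using \<open>irreflp adj\<close> by (intro sum.cong) (auto simp: z_def irreflp_def)
  moreover have "lagrangian adj z (V - {u} - {v}) = lagrangian adj y (V - {u} - {v})"
    by (intro lagrangian_cong) (simp add: z_def)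
  moreover have "lagrangian adj w (V - {u}) =
      lagrangian adj w (V - {u} - {v}) + 2 * w v * sum w {j \<in> V. adj v j}" for w
    using lagrangian_remove[of "V - {u}" v adj w] assms unfolding nbrs by simp
  moreover have "lagrangian adj y V =
      lagrangian adj y (V - {u}) + 2 * y u * sum y {j \<in> V. adj u j}"
    using assms by (intro lagrangian_remove)
  moreover have "y u * sum y {j \<in> V. adj u j} \<le> y u * sum y {j \<in> V. adj v j}"
    using degree_le \<open>0 \<le> y u\<close> by (rule mult_left_mono)
  ultimately show ?thesis unfolding z_def by (simp add: algebra_simps)
qed

lemma lagrangian_clique_le:
  assumes "finite V" "irreflp adj" "pairwise adj V" "card V \<le> r" "r > 0"
  shows "lagrangian adj y V \<le> (1 - 1 / real r) * (sum y V)\<^sup>2"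
proof -
  have "lagrangian adj y V = (\<Sum>i\<in>V. \<Sum>j\<in>V. y i * y j - (if i = j then y i * y j else 0))"
    unfolding lagrangian_def total_weight_def using assms(2,3)
    by (intro sum.cong refl) (auto simp: pairwise_def irreflp_def)
  also have "\<dots> = (sum y V)\<^sup>2 - (\<Sum>i\<in>V. (y i)\<^sup>2)"
    using \<open>finite V\<close> by (simp add: sum_subtractf sum_product power2_eq_square)
  finally have lagrangian_eq: "lagrangian adj y V = (sum y V)\<^sup>2 - (\<Sum>i\<in>V. (y i)\<^sup>2)" .
  have "(sum y V)\<^sup>2 \<le> (\<Sum>i\<in>V. (y i)\<^sup>2) * real (card V)"
    by (rule sum_squared_le_sum_of_squares)
  also have "\<dots> \<le> (\<Sum>i\<in>V. (y i)\<^sup>2) * real r"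
    using \<open>card V \<le> r\<close> by (intro mult_left_mono sum_nonneg) auto
  finally have "(sum y V)\<^sup>2 / real r \<le> (\<Sum>i\<in>V. (y i)\<^sup>2)"
    using \<open>r > 0\<close> by (simp add: field_simps)
  then show ?thesis unfolding lagrangian_eq by (simp add: algebra_simps)
qed

theorem motzkin_straus:
  assumes "finite V" "symp adj" "irreflp adj" "r > 0" "\<And>i. i \<in> V \<Longrightarrow> 0 \<le> y i"
    and clique_free: "\<And>Q. Q \<subseteq> V \<Longrightarrow> card Q = r + 1 \<Longrightarrow> \<not> pairwise adj Q"
  shows "lagrangian adj y V \<le> (1 - 1 / real r) * (sum y V)\<^sup>2"
  using assms(1,5,6)
proof (induction "card V" arbitrary: V y rule: less_induct)
  case less
  note fin = less.prems(1) and nonneg = less.prems(2) and clique_free = less.prems(3)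
  show ?case
  proof (cases "pairwise adj V")
    case True
    have "card V \<le> r"
    proof (rule ccontr)
      assume "\<not> card V \<le> r"
      then obtain Q where "Q \<subseteq> V" "card Q = r + 1"
        using obtain_subset_with_card_n[of "r + 1" V] by auto
      with clique_free pairwise_subset[OF True] show False by blast
    qed
    with fin True assms show ?thesis by (intro lagrangian_clique_le)
  next
    case False
    then obtain a b where ab: "a \<in> V" "b \<in> V" "a \<noteq> b" "\<not> adj a b" "\<not> adj b a"
      using \<open>symp adj\<close> by (auto simp: pairwise_def dest: sympD)
    obtain u v where uv: "u \<in> V" "v \<in> V" "u \<noteq> v" "\<not> adj u v"
        "sum y {j \<in> V. adj u j} \<le> sum y {j \<in> V. adj v j}"
      using that[of a b] that[of b a] ab
        linear[of "sum y {j \<in> V. adj a j}" "sum y {j \<in> V. adj b j}"] by blast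
    define z where "z = y(v := y u + y v)"
    have "lagrangian adj y V \<le> lagrangian adj z (V - {u})"
      unfolding z_def using fin assms(2,3) uv nonneg by (intro lagrangian_le_merge_nonadjacent) auto
    also have "\<dots> \<le> (1 - 1 / real r) * (sum z (V - {u}))\<^sup>2"
    proof (rule less.hyps)
      show "card (V - {u}) < card V" using fin uv(1) by (rule card_Diff1_less)
      show "0 \<le> z i" if "i \<in> V - {u}" for i using that nonneg uv by (auto simp: z_def)
    qed (use fin clique_free in auto)
    also have "sum z (V - {u}) = sum y V" unfolding z_def using fin uv(1-3) by (rule sum_merge)
    finally show ?thesis .
  qed
qed

section \<open>Dense edge weights dominated by vertex weights\<close>

locale dominated_weight =
  fixes h :: "'a \<Rightarrow> 'a \<Rightarrow> real" and y :: "'a \<Rightarrow> real"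
  assumes weight_sym: "h i j = h j i"
    and weight_diag: "h i i = 0"
    and weight_nonneg: "0 \<le> h i j"
    and weight_le: "h i j \<le> y i * y j"
    and mass_nonneg: "0 \<le> y i"
begin

lemma total_weight_le: "total_weight h U \<le> (sum y U)\<^sup>2"
  unfolding total_weight_def power2_eq_square sum_product using weight_le by (intro sum_mono)

lemma dense_set_contains_clique:
  assumes "finite U" "r > 0" and dense: "(1 - 1 / real r) * (sum y U)\<^sup>2 < total_weight h U"
  shows "\<exists>Q\<subseteq>U. card Q = r + 1 \<and> pairwise (\<lambda>i j. 0 < h i j) Q"
proof (rule ccontr)
  assume no_clique: "\<not> ?thesis"
  have "total_weight h U \<le> lagrangian (\<lambda>i j. 0 < h i j) y U"
    unfolding lagrangian_def using weight_le weight_nonneg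
    by (intro total_weight_mono) (auto simp: not_less)
  also have "\<dots> \<le> (1 - 1 / real r) * (sum y U)\<^sup>2"
  proof (rule motzkin_straus)
    show "symp (\<lambda>i j. 0 < h i j)" by (rule sympI) (simp add: weight_sym)
    show "irreflp (\<lambda>i j. 0 < h i j)" by (rule irreflpI) (simp add: weight_diag)
  qed (use assms(1,2) mass_nonneg no_clique in auto)
  finally show False using dense by simp
qed

lemma mass_pos_of_clique:
  assumes "pairwise (\<lambda>i j. 0 < h i j) Q" "card Q \<ge> 2" "v \<in> Q"
  shows "0 < y v"
proof -
  have "Q \<noteq> {v}" using \<open>card Q \<ge> 2\<close> by auto
  with \<open>v \<in> Q\<close> obtain w where "w \<in> Q" "v \<noteq> w" by blast
  with assms(1,3) have "0 < h v w" by (auto simp: pairwise_def)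
  also have "\<dots> \<le> y v * y w" by (rule weight_le)
  finally show ?thesis using mass_nonneg[of v] by (cases "y v = 0") auto
qed

lemma dense_subset_min_degree:
  assumes "finite V" "0 \<le> \<gamma>" "\<gamma> \<le> \<alpha>" and dense: "\<alpha> * (sum y V)\<^sup>2 < total_weight h V"
  obtains U where "U \<subseteq> V" "\<alpha> * (sum y U)\<^sup>2 < total_weight h U"
    "(\<alpha> - \<gamma>) * (sum y V)\<^sup>2 < (sum y U)\<^sup>2"
    "\<And>v. v \<in> U \<Longrightarrow> \<gamma> * y v * (sum y U - y v / 2) \<le> (\<Sum>j\<in>U. h v j)"
proof -
  define excess where "excess U = total_weight h U - \<gamma> * (sum y U)\<^sup>2" for U
  have "Max (excess ` Pow V) \<in> excess ` Pow V"
    using \<open>finite V\<close> by (intro Max_in) auto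
  then obtain U where "U \<subseteq> V" and U_max: "excess U = Max (excess ` Pow V)" by auto
  have excess_le: "excess W \<le> excess U" if "W \<subseteq> V" for W
    unfolding U_max using that \<open>finite V\<close> by (intro Max_ge) auto
  have "finite U" using \<open>U \<subseteq> V\<close> \<open>finite V\<close> by (rule finite_subset)
  have excess_gt: "(\<alpha> - \<gamma>) * (sum y V)\<^sup>2 < excess U"
    using excess_le[of V] dense by (simp add: excess_def algebra_simps)
  show thesis
  proof (rule that[OF \<open>U \<subseteq> V\<close>])
    have "sum y U \<le> sum y V"
      using \<open>U \<subseteq> V\<close> \<open>finite V\<close> mass_nonneg by (intro sum_mono2) auto
    then have "(sum y U)\<^sup>2 \<le> (sum y V)\<^sup>2" using mass_nonneg by (intro power_mono sum_nonneg)
    then have "(\<alpha> - \<gamma>) * (sum y U)\<^sup>2 \<le> (\<alpha> - \<gamma>) * (sum y V)\<^sup>2"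
      using \<open>\<gamma> \<le> \<alpha>\<close> by (intro mult_left_mono) auto
    with excess_gt show "\<alpha> * (sum y U)\<^sup>2 < total_weight h U"
      by (simp add: excess_def algebra_simps)
    have "0 \<le> \<gamma> * (sum y U)\<^sup>2" using \<open>0 \<le> \<gamma>\<close> by simp
    with excess_gt total_weight_le[of U] show "(\<alpha> - \<gamma>) * (sum y V)\<^sup>2 < (sum y U)\<^sup>2"
      by (simp add: excess_def)
    fix v assume "v \<in> U"
    have "total_weight h U = total_weight h (U - {v}) + 2 * (\<Sum>j\<in>U. h v j)"
      using \<open>finite U\<close> \<open>v \<in> U\<close> weight_sym weight_diag by (rule total_weight_remove)
    moreover have "sum y U = y v + sum y (U - {v})"
      using \<open>finite U\<close> \<open>v \<in> U\<close> by (rule sum.remove)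
    moreover have "excess (U - {v}) \<le> excess U" using \<open>U \<subseteq> V\<close> by (intro excess_le) auto
    ultimately show "\<gamma> * y v * (sum y U - y v / 2) \<le> (\<Sum>j\<in>U. h v j)"
      by (simp add: excess_def power2_eq_square algebra_simps)
  qed
qed

lemma dense_set_contains_min_degree_clique:
  assumes "finite V" "r > 0" "0 \<le> \<gamma>" "\<gamma> \<le> 1 - 1 / real r"
    and dense: "(1 - 1 / real r) * (sum y V)\<^sup>2 < total_weight h V"
  obtains U Q where "U \<subseteq> V" "(1 - 1 / real r - \<gamma>) * (sum y V)\<^sup>2 < (sum y U)\<^sup>2"
    "Q \<subseteq> U" "card Q = r + 1" "pairwise (\<lambda>i j. 0 < h i j) Q"
    "\<And>v. v \<in> Q \<Longrightarrow> \<gamma> * y v * (sum y U - y v / 2) \<le> (\<Sum>j\<in>U. h v j)"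
proof -
  obtain U where "U \<subseteq> V" and dense_U: "(1 - 1 / real r) * (sum y U)\<^sup>2 < total_weight h U"
    and mass_U: "(1 - 1 / real r - \<gamma>) * (sum y V)\<^sup>2 < (sum y U)\<^sup>2"
    and degree_ge: "\<And>v. v \<in> U \<Longrightarrow> \<gamma> * y v * (sum y U - y v / 2) \<le> (\<Sum>j\<in>U. h v j)"
    using dense_subset_min_degree[OF assms(1,3,4) dense] by blast
  obtain Q where "Q \<subseteq> U" "card Q = r + 1" "pairwise (\<lambda>i j. 0 < h i j) Q"
    using dense_set_contains_clique[OF finite_subset[OF \<open>U \<subseteq> V\<close> \<open>finite V\<close>] \<open>r > 0\<close> dense_U]
    by blast
  then show thesis using that \<open>U \<subseteq> V\<close> mass_U degree_ge by blast
qed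

lemma normalized_degree_sum_ge:
  assumes "finite U" "Q \<subseteq> U" "0 \<le> \<gamma>" and mass_pos: "\<And>v. v \<in> Q \<Longrightarrow> 0 < y v"
    and degree_ge: "\<And>v. v \<in> Q \<Longrightarrow> \<gamma> * y v * (sum y U - y v / 2) \<le> (\<Sum>j\<in>U. h v j)"
  shows "\<gamma> * (real (card Q) - 1 / 2) * sum y U \<le> (\<Sum>j\<in>U. \<Sum>v\<in>Q. h v j / y v)"
proof -
  have "sum y Q \<le> sum y U" using assms(1,2) mass_nonneg by (intro sum_mono2) auto
  then have "\<gamma> * (real (card Q) - 1 / 2) * sum y U \<le>
      \<gamma> * (real (card Q) * sum y U - sum y Q / 2)"
    unfolding mult.assoc using \<open>0 \<le> \<gamma>\<close> by (intro mult_left_mono) (auto simp: algebra_simps)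
  also have "\<dots> = (\<Sum>v\<in>Q. \<gamma> * (sum y U - y v / 2))"
    by (simp add: sum_subtractf flip: sum_distrib_left sum_divide_distrib)
  also have "\<dots> \<le> (\<Sum>v\<in>Q. \<Sum>j\<in>U. h v j / y v)"
    using mass_pos degree_ge
    by (intro sum_mono) (simp add: pos_le_divide_eq mult_ac flip: sum_divide_distrib)
  also have "\<dots> = (\<Sum>j\<in>U. \<Sum>v\<in>Q. h v j / y v)" by (rule sum.swap)
  finally show ?thesis .
qed

end

section \<open>Truncated edge weights\<close>

definition near_common_neighbours :: "('a \<Rightarrow> 'a \<Rightarrow> bool) \<Rightarrow> 'a set \<Rightarrow> 'a set \<Rightarrow> 'a set" where
  "near_common_neighbours adj Q V = {j \<in> V. card {v \<in> Q. \<not> adj v j} \<le> 1}"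

text \<open>If every weighted degree, divided by the mass of its vertex, is about the fraction \<open>\<gamma>\<close> of the
  total mass, then \<open>\<gamma> (r + 1/2) - (r - 1)\<close> is a lower bound for the share of the
  normalised degree sum of an \<open>(r+1)\<close>-clique that comes from its near common neighbours; the last
  factor bounds the square of the mass from below.\<close>

definition near_neighbour_const :: "real \<Rightarrow> nat \<Rightarrow> real" where
  "near_neighbour_const \<gamma> r =
    ((\<gamma> * (real r + 1 / 2) - (real r - 1)) / (4 * (real r + 1)))\<^sup>2 * (1 - 1 / real r - \<gamma>)"

lemma sum_squared_le_card_of_unit:
  fixes x :: "'a \<Rightarrow> real"
  assumes "finite V" "T \<subseteq> V" and unit: "(\<Sum>i\<in>V. (x i)\<^sup>2) = 1"
  shows "(sum x T)\<^sup>2 \<le> real (card T)"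
proof -
  have "(sum x T)\<^sup>2 \<le> (\<Sum>i\<in>T. (x i)\<^sup>2) * real (card T)"
    by (rule sum_squared_le_sum_of_squares)
  also have "\<dots> \<le> (\<Sum>i\<in>V. (x i)\<^sup>2) * real (card T)"
    using assms(1,2) by (intro mult_right_mono sum_mono2) auto
  finally show ?thesis using unit by simp
qed

locale truncated_weight =
  fixes adj :: "'a \<Rightarrow> 'a \<Rightarrow> bool" and x :: "'a \<Rightarrow> real" and \<tau> :: real
  assumes adj_symp: "symp adj"
    and adj_irreflp: "irreflp adj"
    and x_nonneg: "0 \<le> x i"
    and \<tau>_pos: "0 < \<tau>"
begin

definition weight :: "'a \<Rightarrow> 'a \<Rightarrow> real" where
  "weight i j = (if adj i j then max 0 (2 * \<tau> * (x i * x j) - \<tau>\<^sup>2) else 0)"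

lemma weight_le_product: "weight i j \<le> (x i)\<^sup>2 * (x j)\<^sup>2"
proof -
  have "0 \<le> (x i * x j - \<tau>)\<^sup>2" by simp
  then have "2 * \<tau> * (x i * x j) - \<tau>\<^sup>2 \<le> (x i)\<^sup>2 * (x j)\<^sup>2"
    by (simp add: power2_eq_square algebra_simps)
  then show ?thesis by (simp add: weight_def)
qed

sublocale dominated_weight weight "\<lambda>i. (x i)\<^sup>2"
proof
  show "weight i j = weight j i" for i j
    using adj_symp by (auto simp: weight_def mult.commute dest: sympD)
  show "weight i i = 0" for i
    using adj_irreflp by (simp add: weight_def irreflp_def)
qed (simp_all add: weight_le_product, simp add: weight_def)

lemma total_weight_ge:
  "2 * \<tau> * lagrangian adj x V - \<tau>\<^sup>2 * lagrangian adj (\<lambda>_. 1) V \<le> total_weight weight V"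
proof -
  have "2 * \<tau> * lagrangian adj x V - \<tau>\<^sup>2 * lagrangian adj (\<lambda>_. 1) V =
      total_weight (\<lambda>i j. if adj i j then 2 * \<tau> * (x i * x j) - \<tau>\<^sup>2 else 0) V"
    unfolding lagrangian_def total_weight_def sum_distrib_left sum_subtractf[symmetric]
    by (intro sum.cong refl) simp
  also have "\<dots> \<le> total_weight weight V"
    by (intro total_weight_mono) (simp add: weight_def)
  finally show ?thesis .
qed

lemma weight_posD:
  assumes "0 < weight i j"
  shows "adj i j" "\<tau> < 2 * (x i * x j)"
proof -
  show "adj i j" using assms by (simp add: weight_def split: if_splits)
  have "0 < 2 * \<tau> * (x i * x j) - \<tau>\<^sup>2"
    using assms by (simp add: weight_def max_def split: if_splits)
  then have "0 < \<tau> * (2 * (x i * x j) - \<tau>)" by (simp add: power2_eq_square algebra_simps)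
  then show "\<tau> < 2 * (x i * x j)" using \<tau>_pos by (simp add: zero_less_mult_iff)
qed

lemma clique_adjacent:
  assumes "pairwise (\<lambda>i j. 0 < weight i j) Q"
  shows "pairwise adj Q"
  using assms weight_posD(1) by (auto simp: pairwise_def)

lemma normalized_weight_le_mass:
  assumes "0 < (x v)\<^sup>2"
  shows "weight v j / (x v)\<^sup>2 \<le> (if adj v j then (x j)\<^sup>2 else 0)"
  using assms weight_le[of v j] by (auto simp: weight_def divide_le_eq mult.commute)

lemma normalized_weight_le_of_heavy:
  assumes heavy: "sqrt \<tau> / 2 \<le> x v"
  shows "weight v j / (x v)\<^sup>2 \<le> 4 * sqrt \<tau> * x j"
proof -
  have "0 < x v" using heavy \<tau>_pos by (smt (verit) half_gt_zero real_sqrt_gt_zero)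
  have "weight v j \<le> 2 * \<tau> * (x v * x j)"
    using x_nonneg \<tau>_pos by (simp add: weight_def)
  also have "\<dots> = 2 * sqrt \<tau> * x v * x j * sqrt \<tau>" using \<tau>_pos by simp
  also have "\<dots> \<le> 2 * sqrt \<tau> * x v * x j * (2 * x v)"
    using heavy x_nonneg \<tau>_pos by (intro mult_left_mono) auto
  finally show ?thesis using \<open>0 < x v\<close> by (simp add: divide_le_eq power2_eq_square mult_ac)
qed

lemma card_light_le_one:
  assumes "finite Q" "pairwise (\<lambda>i j. 0 < weight i j) Q"
  shows "card {v \<in> Q. x v < sqrt \<tau> / 2} \<le> 1"
proof -
  have "v = w" if "v \<in> Q" "w \<in> Q" "x v < sqrt \<tau> / 2" "x w < sqrt \<tau> / 2" for v w
  proof (rule ccontr)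
    assume "v \<noteq> w"
    then have "\<tau> < 2 * (x v * x w)"
      using assms(2) that(1,2) by (intro weight_posD(2)) (simp add: pairwise_def)
    moreover have "x v * x w \<le> (sqrt \<tau> / 2) * (sqrt \<tau> / 2)"
      using that(3,4) x_nonneg \<tau>_pos by (intro mult_mono) auto
    ultimately show False using \<tau>_pos by simp
  qed
  then show ?thesis using \<open>finite Q\<close> by (auto simp: card_le_Suc0_iff_eq)
qed

lemma normalized_weight_sum_le:
  assumes "finite Q" "card Q \<ge> 3" and Q_clique: "pairwise (\<lambda>i j. 0 < weight i j) Q" and "j \<in> U"
  shows "(\<Sum>v\<in>Q. weight v j / (x v)\<^sup>2) \<le> (real (card Q) - 2) * (x j)\<^sup>2 +
    (if j \<in> near_common_neighbours adj Q U then 4 * real (card Q) * sqrt \<tau> * x j else 0)"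
proof -
  have mass_pos: "0 < (x v)\<^sup>2" if "v \<in> Q" for v
    using Q_clique _ that by (rule mass_pos_of_clique) (use \<open>card Q \<ge> 3\<close> in simp)
  show ?thesis
  proof (cases "j \<in> near_common_neighbours adj Q U")
    case True
    define light where "light = {v \<in> Q. x v < sqrt \<tau> / 2}"
    have "(\<Sum>v\<in>light. weight v j / (x v)\<^sup>2) \<le> (\<Sum>v\<in>light. (x j)\<^sup>2)"
      using mass_pos by (intro sum_mono order_trans[OF normalized_weight_le_mass])
        (auto simp: light_def)
    also have "\<dots> \<le> (real (card Q) - 2) * (x j)\<^sup>2"
      using card_light_le_one[OF \<open>finite Q\<close> Q_clique] \<open>card Q \<ge> 3\<close>
      by (simp add: light_def mult_right_mono)
    finally have light_le: "(\<Sum>v\<in>light. weight v j / (x v)\<^sup>2) \<le> (real (card Q) - 2) * (x j)\<^sup>2" .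
    have "(\<Sum>v\<in>Q-light. weight v j / (x v)\<^sup>2) \<le> (\<Sum>v\<in>Q-light. 4 * sqrt \<tau> * x j)"
      by (intro sum_mono normalized_weight_le_of_heavy) (auto simp: light_def)
    also have "\<dots> \<le> (\<Sum>v\<in>Q. 4 * sqrt \<tau> * x j)"
      using \<open>finite Q\<close> x_nonneg \<tau>_pos by (intro sum_mono2) auto
    finally have "(\<Sum>v\<in>Q-light. weight v j / (x v)\<^sup>2) \<le> 4 * real (card Q) * sqrt \<tau> * x j"
      by simp
    then show ?thesis
      using True light_le \<open>finite Q\<close> sum.subset_diff[of light Q "\<lambda>v. weight v j / (x v)\<^sup>2"]
      by (simp add: light_def)
  next
    case False
    have "card Q = card {v \<in> Q. adj v j} + card {v \<in> Q. \<not> adj v j}"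
      using \<open>finite Q\<close> by (subst card_Un_disjoint[symmetric]) (auto intro: arg_cong[of _ _ card])
    with False \<open>j \<in> U\<close> have card_adj: "real (card {v \<in> Q. adj v j}) \<le> real (card Q) - 2"
      by (simp add: near_common_neighbours_def)
    have "(\<Sum>v\<in>Q. weight v j / (x v)\<^sup>2) \<le> (\<Sum>v\<in>Q. if adj v j then (x j)\<^sup>2 else 0)"
      using mass_pos by (intro sum_mono normalized_weight_le_mass)
    also have "\<dots> = real (card {v \<in> Q. adj v j}) * (x j)\<^sup>2"
      using \<open>finite Q\<close> by (simp flip: sum.inter_filter)
    also have "\<dots> \<le> (real (card Q) - 2) * (x j)\<^sup>2" using card_adj by (simp add: mult_right_mono)
    finally show ?thesis using False by simp
  qed
qed

lemma near_common_neighbours_sum_ge: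
  assumes "finite U" "Q \<subseteq> U" "card Q \<ge> 3" "0 \<le> \<gamma>"
    and Q_clique: "pairwise (\<lambda>i j. 0 < weight i j) Q"
    and degree_ge: "\<And>v. v \<in> Q \<Longrightarrow>
      \<gamma> * (x v)\<^sup>2 * ((\<Sum>i\<in>U. (x i)\<^sup>2) - (x v)\<^sup>2 / 2) \<le> (\<Sum>j\<in>U. weight v j)"
  shows "(\<gamma> * (real (card Q) - 1 / 2) - (real (card Q) - 2)) * (\<Sum>i\<in>U. (x i)\<^sup>2)
    \<le> 4 * real (card Q) * sqrt \<tau> * sum x (near_common_neighbours adj Q U)"
proof -
  let ?N = "near_common_neighbours adj Q U"
  have "finite Q" using \<open>Q \<subseteq> U\<close> \<open>finite U\<close> by (rule finite_subset)
  have "\<gamma> * (real (card Q) - 1 / 2) * (\<Sum>i\<in>U. (x i)\<^sup>2) \<le> (\<Sum>j\<in>U. \<Sum>v\<in>Q. weight v j / (x v)\<^sup>2)"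
    using \<open>finite U\<close> \<open>Q \<subseteq> U\<close> \<open>0 \<le> \<gamma>\<close> mass_pos_of_clique[OF Q_clique] degree_ge \<open>card Q \<ge> 3\<close>
    by (intro normalized_degree_sum_ge) auto
  also have "\<dots> \<le> (\<Sum>j\<in>U. (real (card Q) - 2) * (x j)\<^sup>2 +
      (if j \<in> ?N then 4 * real (card Q) * sqrt \<tau> * x j else 0))"
    using \<open>finite Q\<close> \<open>card Q \<ge> 3\<close> Q_clique by (intro sum_mono normalized_weight_sum_le)
  also have "\<dots> = (real (card Q) - 2) * (\<Sum>i\<in>U. (x i)\<^sup>2) +
      4 * real (card Q) * sqrt \<tau> * sum x (U \<inter> ?N)"
    using \<open>finite U\<close> by (simp add: sum.distrib sum_distrib_left flip: sum.inter_restrict)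
  also have "U \<inter> ?N = ?N" by (auto simp: near_common_neighbours_def)
  finally show ?thesis by (simp add: algebra_simps)
qed

lemma near_common_neighbours_card_ge:
  assumes "finite V" "r \<ge> 2" and unit: "(\<Sum>i\<in>V. (x i)\<^sup>2) = 1"
    and dense: "1 - 1 / real r < total_weight weight V"
    and \<gamma>: "0 \<le> \<gamma>" "\<gamma> \<le> 1 - 1 / real r" "real r - 1 \<le> \<gamma> * (real r + 1 / 2)"
  obtains Q where "Q \<subseteq> V" "card Q = r + 1" "pairwise adj Q"
    "near_neighbour_const \<gamma> r \<le> \<tau> * real (card (near_common_neighbours adj Q V))"
proof -
  obtain U Q where "U \<subseteq> V" and mass_U: "1 - 1 / real r - \<gamma> < (\<Sum>i\<in>U. (x i)\<^sup>2)\<^sup>2"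
    and Q: "Q \<subseteq> U" "card Q = r + 1" "pairwise (\<lambda>i j. 0 < weight i j) Q"
    and degree_ge: "\<And>v. v \<in> Q \<Longrightarrow>
      \<gamma> * (x v)\<^sup>2 * ((\<Sum>i\<in>U. (x i)\<^sup>2) - (x v)\<^sup>2 / 2) \<le> (\<Sum>j\<in>U. weight v j)"
    using dense_set_contains_min_degree_clique[of V r \<gamma>] assms by auto
  have "finite U" using \<open>U \<subseteq> V\<close> \<open>finite V\<close> by (rule finite_subset)
  define \<delta> where "\<delta> = (\<gamma> * (real r + 1 / 2) - (real r - 1)) / (4 * (real r + 1))"
  define Y where "Y = (\<Sum>i\<in>U. (x i)\<^sup>2)"
  define N where "N = near_common_neighbours adj Q U"
  have N_subset: "N \<subseteq> near_common_neighbours adj Q V" "N \<subseteq> V"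
    using \<open>U \<subseteq> V\<close> by (auto simp: N_def near_common_neighbours_def)
  have "(\<gamma> * (real r + 1 / 2) - (real r - 1)) * Y \<le> 4 * (real r + 1) * sqrt \<tau> * sum x N"
    using near_common_neighbours_sum_ge[OF \<open>finite U\<close> Q(1) _ \<gamma>(1) Q(3) degree_ge] Q(2) \<open>r \<ge> 2\<close>
    by (simp add: Y_def N_def add.commute)
  then have "\<delta> * Y \<le> sqrt \<tau> * sum x N" by (simp add: \<delta>_def divide_le_eq mult_ac)
  moreover have "0 \<le> \<delta> * Y" using \<gamma>(3) by (simp add: \<delta>_def Y_def sum_nonneg)
  ultimately have "(\<delta> * Y)\<^sup>2 \<le> (sqrt \<tau> * sum x N)\<^sup>2" by (rule power_mono)
  also have "\<dots> = \<tau> * (sum x N)\<^sup>2" using \<tau>_pos by (simp add: power_mult_distrib)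
  also have "\<dots> \<le> \<tau> * real (card N)"
    using sum_squared_le_card_of_unit[OF \<open>finite V\<close> N_subset(2) unit] \<tau>_pos by simp
  also have "\<dots> \<le> \<tau> * real (card (near_common_neighbours adj Q V))"
    using N_subset(1) \<open>finite V\<close> \<tau>_pos
    by (auto simp: near_common_neighbours_def intro!: mult_left_mono card_mono)
  finally have "(\<delta> * Y)\<^sup>2 \<le> \<tau> * real (card (near_common_neighbours adj Q V))" .
  moreover have "near_neighbour_const \<gamma> r \<le> (\<delta> * Y)\<^sup>2"
    unfolding near_neighbour_const_def \<delta>_def[symmetric] power_mult_distrib
    using mass_U by (intro mult_left_mono) (auto simp: Y_def)
  ultimately show thesis
    using that[of Q] Q(1,2) \<open>U \<subseteq> V\<close> clique_adjacent[OF Q(3)] by simp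
qed

end

theorem large_lagrangian_near_common_neighbours:
  assumes "finite V" "r \<ge> 2" "symp adj" "irreflp adj" "\<And>i. 0 \<le> x i"
    and unit: "(\<Sum>i\<in>V. (x i)\<^sup>2) = 1"
    and large: "(1 - 1 / real r) * lagrangian adj (\<lambda>_. 1) V < (lagrangian adj x V)\<^sup>2"
    and \<gamma>: "0 \<le> \<gamma>" "\<gamma> \<le> 1 - 1 / real r" "real r - 1 \<le> \<gamma> * (real r + 1 / 2)"
  obtains Q where "Q \<subseteq> V" "card Q = r + 1" "pairwise adj Q"
    "near_neighbour_const \<gamma> r * sqrt (lagrangian adj (\<lambda>_. 1) V)
      \<le> real (card (near_common_neighbours adj Q V))"
proof -
  define L where "L = lagrangian adj x V"
  define M where "M = lagrangian adj (\<lambda>_. 1) V"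
  define \<tau> where "\<tau> = L / M"
  have "0 \<le> M" unfolding M_def by (intro lagrangian_nonneg) simp
  have "L\<^sup>2 \<le> M" using lagrangian_squared_le[of adj x V] unit by (simp add: L_def M_def)
  have "0 \<le> (1 - 1 / real r) * M" using \<open>0 \<le> M\<close> \<open>r \<ge> 2\<close> by simp
  with large have "L \<noteq> 0" by (auto simp: L_def M_def)
  moreover have "0 \<le> L" unfolding L_def using assms(5) by (intro lagrangian_nonneg)
  ultimately have "0 < L" by simp
  then have "0 < M" using \<open>L\<^sup>2 \<le> M\<close> by (smt (verit) zero_less_power)
  interpret truncated_weight adj x \<tau>
    using assms \<open>0 < L\<close> \<open>0 < M\<close> by unfold_locales (auto simp: \<tau>_def)
  \<comment> \<open>\<open>L / M\<close> maximises the quadratic \<open>2 * \<tau> * L - \<tau>\<^sup>2 * M\<close>.\<close>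
  have "1 - 1 / real r < L\<^sup>2 / M" using large \<open>0 < M\<close> by (simp add: L_def M_def less_divide_eq)
  also have "\<dots> = 2 * \<tau> * L - \<tau>\<^sup>2 * M"
    using \<open>0 < M\<close> by (simp add: \<tau>_def field_simps power2_eq_square)
  also have "\<dots> \<le> total_weight weight V" unfolding L_def M_def by (rule total_weight_ge)
  finally have "1 - 1 / real r < total_weight weight V" .
  then obtain Q where Q: "Q \<subseteq> V" "card Q = r + 1" "pairwise adj Q"
    and const_le: "near_neighbour_const \<gamma> r \<le> \<tau> * real (card (near_common_neighbours adj Q V))"
    using near_common_neighbours_card_ge[OF \<open>finite V\<close> \<open>r \<ge> 2\<close> unit _ \<gamma>] by blast
  have "L \<le> sqrt M" using \<open>L\<^sup>2 \<le> M\<close> by (rule real_le_rsqrt)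
  then have "\<tau> \<le> sqrt M / M"
    unfolding \<tau>_def using \<open>0 \<le> M\<close> by (rule divide_right_mono)
  also have "\<dots> = 1 / sqrt M" by (simp add: sqrt_divide_self_eq \<open>0 \<le> M\<close> inverse_eq_divide)
  finally have "\<tau> * sqrt M \<le> 1" using \<open>0 < M\<close> by (simp add: le_divide_eq)
  let ?k = "real (card (near_common_neighbours adj Q V))"
  have "near_neighbour_const \<gamma> r * sqrt M \<le> \<tau> * ?k * sqrt M"
    using const_le \<open>0 \<le> M\<close> by (intro mult_right_mono) auto
  also have "\<dots> = \<tau> * sqrt M * ?k" by simp
  also have "\<dots> \<le> 1 * ?k" using \<open>\<tau> * sqrt M \<le> 1\<close> by (intro mult_right_mono) auto
  finally have "near_neighbour_const \<gamma> r * sqrt M \<le> ?k" by simp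
  with Q show thesis unfolding M_def by (rule that)
qed

section \<open>Eigenvalues of symmetric matrices\<close>

lemma eigenvector_bilinear_form:
  fixes A :: "'a :: comm_ring_1 mat"
  assumes A: "A \<in> carrier_mat n n" and "eigenvector A v k"
  shows "(\<Sum>i<n. \<Sum>j<n. w i * (A $$ (i, j) * v $ j)) = k * (\<Sum>i<n. w i * v $ i)"
proof -
  have v: "v \<in> carrier_vec n" "A *\<^sub>v v = k \<cdot>\<^sub>v v" using assms by (auto simp: eigenvector_def)
  have "(\<Sum>j<n. A $$ (i, j) * v $ j) = k * v $ i" if "i < n" for i
  proof -
    have "(\<Sum>j<n. A $$ (i, j) * v $ j) = (A *\<^sub>v v) $ i"
      using A v(1) that
      by (auto simp: scalar_prod_def lessThan_atLeast0 intro!: sum.cong)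
    then show ?thesis using v that by simp
  qed
  then have "(\<Sum>i<n. \<Sum>j<n. w i * (A $$ (i, j) * v $ j)) = (\<Sum>i<n. w i * (k * v $ i))"
    by (simp flip: sum_distrib_left)
  then show ?thesis by (simp add: sum_distrib_left mult.left_commute)
qed

lemma eigenvector_norm_sum_pos:
  fixes A :: "'a :: real_normed_field mat"
  assumes "A \<in> carrier_mat n n" "eigenvector A v k"
  shows "0 < (\<Sum>i<n. (norm (v $ i))\<^sup>2)"
proof -
  have "\<exists>i<n. v $ i \<noteq> 0"
  proof (rule ccontr)
    assume "\<not> ?thesis"
    then have "v = 0\<^sub>v n" using assms by (intro eq_vecI) (auto simp: eigenvector_def)
    with assms show False by (auto simp: eigenvector_def)
  qed
  then obtain i where "i < n" "v $ i \<noteq> 0" by blast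
  then show ?thesis by (intro sum_pos2[of _ i]) auto
qed

lemma hermitian_mat_eigenvalue_real:
  assumes B: "B \<in> carrier_mat n n" and "eigenvalue B c"
    and hermitian: "\<And>i j. i < n \<Longrightarrow> j < n \<Longrightarrow> B $$ (j, i) = cnj (B $$ (i, j))"
  shows "c \<in> \<real>"
proof -
  obtain v where v: "eigenvector B v c" using assms(2) by (auto simp: eigenvalue_def)
  define z where "z = (\<Sum>i<n. \<Sum>j<n. cnj (v $ i) * (B $$ (i, j) * v $ j))"
  define N where "N = (\<Sum>i<n. (cmod (v $ i))\<^sup>2)"
  have "0 < N" unfolding N_def using B v by (rule eigenvector_norm_sum_pos)
  have "z = c * (\<Sum>i<n. cnj (v $ i) * v $ i)"
    unfolding z_def using B v by (rule eigenvector_bilinear_form)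
  then have z_eq: "z = c * of_real N"
    by (simp add: N_def complex_norm_square mult.commute del: of_real_power)
  have "cnj z = (\<Sum>i<n. \<Sum>j<n. v $ i * (cnj (B $$ (i, j)) * cnj (v $ j)))"
    by (simp add: z_def)
  also have "\<dots> = (\<Sum>j<n. \<Sum>i<n. v $ i * (cnj (B $$ (i, j)) * cnj (v $ j)))"
    by (rule sum.swap)
  also have "\<dots> = z"
    unfolding z_def by (intro sum.cong refl) (simp add: hermitian[symmetric] mult_ac)
  finally have "cnj c = c" using z_eq \<open>0 < N\<close> by simp
  then show ?thesis by (simp add: Reals_cnj_iff)
qed

lemma symmetric_mat_spectrum_nonempty:
  fixes A :: "real mat"
  assumes A: "A \<in> carrier_mat n n" and "n > 0"
    and sym: "\<And>i j. i < n \<Longrightarrow> j < n \<Longrightarrow> A $$ (i, j) = A $$ (j, i)"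
  shows "spectrum A \<noteq> {}"
proof -
  define B where "B = map_mat complex_of_real A"
  have B: "B \<in> carrier_mat n n" using A by (simp add: B_def)
  obtain c where c: "eigenvalue B c"
    using spectrum_non_empty[OF B \<open>n > 0\<close>] by (auto simp: spectrum_def)
  have "c \<in> \<real>"
    using B c by (rule hermitian_mat_eigenvalue_real) (use A sym in \<open>auto simp: B_def\<close>)
  then obtain t where t: "c = of_real t" by (rule Reals_cases)
  have "poly (char_poly B) c = 0" using c eigenvalue_root_char_poly[OF B] by simp
  then have "poly (char_poly A) t = 0"
    unfolding B_def t of_real_hom.char_poly_hom[OF A] by simp
  then show ?thesis by (auto simp: spectrum_root_char_poly[OF A])
qed

lemma nonneg_mat_abs_eigenvalue_le:
  fixes A :: "real mat"
  assumes A: "A \<in> carrier_mat n n" and "eigenvalue A k"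
    and nonneg: "\<And>i j. i < n \<Longrightarrow> j < n \<Longrightarrow> 0 \<le> A $$ (i, j)"
  obtains x :: "nat \<Rightarrow> real" where "\<And>i. 0 \<le> x i" "(\<Sum>i<n. (x i)\<^sup>2) = 1"
    "\<bar>k\<bar> \<le> (\<Sum>i<n. \<Sum>j<n. A $$ (i, j) * (x i * x j))"
proof -
  obtain v where v: "eigenvector A v k" using assms(2) by (auto simp: eigenvalue_def)
  define N where "N = (\<Sum>i<n. (v $ i)\<^sup>2)"
  have "0 < N" unfolding N_def using eigenvector_norm_sum_pos[OF A v] by simp
  define x where "x i = \<bar>v $ i\<bar> / sqrt N" for i
  have x_prod: "x i * x j = \<bar>v $ i\<bar> * \<bar>v $ j\<bar> / N" for i j
    using \<open>0 < N\<close> by (simp add: x_def)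
  show thesis
  proof
    show "0 \<le> x i" for i using \<open>0 < N\<close> by (simp add: x_def)
    show "(\<Sum>i<n. (x i)\<^sup>2) = 1"
      using \<open>0 < N\<close> by (simp add: x_def power_divide N_def flip: sum_divide_distrib)
    have "k = (\<Sum>i<n. \<Sum>j<n. v $ i / N * (A $$ (i, j) * v $ j))"
      unfolding eigenvector_bilinear_form[OF A v] using \<open>0 < N\<close>
      by (simp add: N_def power2_eq_square flip: sum_divide_distrib)
    also have "\<bar>\<dots>\<bar> \<le> (\<Sum>i<n. \<Sum>j<n. \<bar>v $ i / N * (A $$ (i, j) * v $ j)\<bar>)"
      by (intro order_trans[OF sum_abs] sum_mono) auto
    also have "\<dots> = (\<Sum>i<n. \<Sum>j<n. A $$ (i, j) * (x i * x j))"
      using \<open>0 < N\<close> nonneg by (intro sum.cong refl) (simp add: x_prod abs_mult)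
    finally show "\<bar>k\<bar> \<le> (\<Sum>i<n. \<Sum>j<n. A $$ (i, j) * (x i * x j))" .
  qed
qed

section \<open>Books in graphs of large spectral radius\<close>

definition adjacent :: "nat set set \<Rightarrow> nat \<Rightarrow> nat \<Rightarrow> bool" where
  "adjacent E i j \<longleftrightarrow> {i, j} \<in> E"

lemma symp_adjacent: "symp (adjacent E)"
  by (rule sympI) (simp add: adjacent_def insert_commute)

lemma irreflp_adjacent: "simple_graph n E \<Longrightarrow> irreflp (adjacent E)"
  by (rule irreflpI) (auto simp: adjacent_def simple_graph_def dest!: bspec)

lemma adjacency_matrix_carrier: "adjacency_matrix n E \<in> carrier_mat n n"
  by (simp add: adjacency_matrix_def)

lemma adjacency_matrix_entry:
  "i < n \<Longrightarrow> j < n \<Longrightarrow> adjacency_matrix n E $$ (i, j) = (if adjacent E i j then 1 else 0)"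
  by (simp add: adjacency_matrix_def adjacent_def)

lemma largest_eigenvalue_is_eigenvalue:
  assumes "n > 0"
  shows "eigenvalue (adjacency_matrix n E) (largest_eigenvalue n E)"
proof -
  have "spectrum (adjacency_matrix n E) \<noteq> {}"
    using adjacency_matrix_carrier assms
    by (rule symmetric_mat_spectrum_nonempty)
      (use symp_adjacent[of E] in \<open>auto simp: adjacency_matrix_entry dest: sympD\<close>)
  then have "largest_eigenvalue n E \<in> spectrum (adjacency_matrix n E)"
    unfolding largest_eigenvalue_def
    using card_finite_spectrum(1)[OF adjacency_matrix_carrier] by (intro Max_in)
  then show ?thesis by (simp add: spectrum_def)
qed

lemma eigenvalue_le_largest_eigenvalue:
  assumes "eigenvalue (adjacency_matrix n E) k"
  shows "k \<le> largest_eigenvalue n E"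
  unfolding largest_eigenvalue_def
  using assms card_finite_spectrum(1)[OF adjacency_matrix_carrier]
  by (intro Max_ge) (auto simp: spectrum_def)

lemma abs_largest_eigenvalue_le_lagrangian:
  assumes "n > 0"
  obtains x :: "nat \<Rightarrow> real" where "\<And>i. 0 \<le> x i" "(\<Sum>i<n. (x i)\<^sup>2) = 1"
    "\<bar>largest_eigenvalue n E\<bar> \<le> lagrangian (adjacent E) x {..<n}"
proof -
  have form_eq: "(\<Sum>i<n. \<Sum>j<n. adjacency_matrix n E $$ (i, j) * (x i * x j)) =
      lagrangian (adjacent E) x {..<n}" for x
    unfolding lagrangian_def total_weight_def
    by (intro sum.cong refl) (simp add: adjacency_matrix_entry)
  obtain x where "\<And>i. 0 \<le> x i" "(\<Sum>i<n. (x i)\<^sup>2) = 1" "\<bar>largest_eigenvalue n E\<bar> \<le>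
      (\<Sum>i<n. \<Sum>j<n. adjacency_matrix n E $$ (i, j) * (x i * x j))"
    by (rule nonneg_mat_abs_eigenvalue_le[OF adjacency_matrix_carrier
          largest_eigenvalue_is_eigenvalue[OF assms, of E]])
      (auto simp: adjacency_matrix_entry)
  then show thesis unfolding form_eq by (rule that)
qed

lemma lagrangian_one_eq_card_edges:
  assumes "simple_graph n E"
  shows "lagrangian (adjacent E) (\<lambda>_. 1) {..<n} = 2 * real (card E)"
proof -
  define ends where "ends e = {(i, j). {i, j} = e}" for e :: "nat set"
  have "finite E"
    by (rule finite_subset[of _ "Pow {..<n}"]) (use assms in \<open>auto simp: simple_graph_def\<close>)
  have ends: "finite (ends e)" "card (ends e) = 2" if "e \<in> E" for e
  proof -
    have "card e = 2" using assms that by (simp add: simple_graph_def)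
    then obtain a b where "e = {a, b}" "a \<noteq> b" by (auto simp: card_2_iff)
    then have "ends e = {(a, b), (b, a)}" by (auto simp: ends_def doubleton_eq_iff)
    with \<open>a \<noteq> b\<close> show "finite (ends e)" "card (ends e) = 2" by simp_all
  qed
  have "lagrangian (adjacent E) (\<lambda>_. 1) {..<n} =
      (\<Sum>p\<in>{..<n}\<times>{..<n}. if {fst p, snd p} \<in> E then 1 else 0)"
    unfolding lagrangian_def total_weight_def sum.cartesian_product
    by (intro sum.cong) (auto simp: adjacent_def)
  also have "\<dots> = real (card {p \<in> {..<n}\<times>{..<n}. {fst p, snd p} \<in> E})"
    by (simp add: sum.If_cases Int_def)
  also have "{p \<in> {..<n}\<times>{..<n}. {fst p, snd p} \<in> E} = (\<Union>e\<in>E. ends e)"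
    using assms by (auto simp: ends_def simple_graph_def)
  also have "card \<dots> = (\<Sum>e\<in>E. card (ends e))"
    using \<open>finite E\<close> ends(1) by (intro card_UN_disjoint) (auto simp: ends_def)
  also have "\<dots> = 2 * card E" using ends(2) by simp
  finally show ?thesis by simp
qed

lemma contains_bookI:
  assumes R: "R \<subseteq> {..<n}" "card R = r" and W: "W \<subseteq> {..<n}"
    and R_clique: "pairwise (adjacent E) R"
    and joined: "\<And>i j. i \<in> R \<Longrightarrow> j \<in> W \<Longrightarrow> adjacent E i j" and "R \<inter> W = {}"
  shows "contains_book n E r (card W)"
proof -
  have "finite R" "finite W" using R W by (auto intro: finite_subset)
  then obtain f g where "bij_betw f {..<r} R" "bij_betw g {r..<r + card W} W"
    using R(2) finite_same_card_bij[of "{..<r}" R] finite_same_card_bij[of "{r..<r + card W}" W]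
    by auto
  define \<phi> where "\<phi> i = (if i \<in> {..<r} then f i else g i)" for i
  have "bij_betw \<phi> ({..<r} \<union> {r..<r + card W}) (R \<union> W)"
    unfolding \<phi>_def using \<open>bij_betw f _ _\<close> \<open>bij_betw g _ _\<close> \<open>R \<inter> W = {}\<close>
    by (intro bij_betw_disjoint_Un) auto
  then have \<phi>: "inj_on \<phi> {..<r + card W}" "\<phi> ` {..<r + card W} = R \<union> W"
    by (simp_all add: bij_betw_def ivl_disj_un_one)
  have \<phi>_R: "\<phi> i \<in> R" if "i < r" for i
    using \<open>bij_betw f _ _\<close> that by (auto simp: \<phi>_def bij_betw_def)
  have \<phi>_W: "\<phi> i \<in> W" if "r \<le> i" "i < r + card W" for i
    using \<open>bij_betw g _ _\<close> that by (auto simp: \<phi>_def bij_betw_def)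
  have "\<phi> ` e \<in> E" if "e \<in> book_edges r (card W)" for e
  proof -
    from that consider (clique) i j where "e = {i, j}" "i < r" "j < r" "i \<noteq> j"
      | (page) i j where "e = {i, j}" "i < r" "r \<le> j" "j < r + card W"
      unfolding book_edges_def by blast
    then show ?thesis
    proof cases
      case clique
      then have "\<phi> i \<noteq> \<phi> j" using \<phi>(1) by (auto simp: inj_on_def)
      with clique R_clique \<phi>_R show ?thesis by (simp add: pairwise_def adjacent_def)
    next
      case page
      then show ?thesis using joined[OF \<phi>_R \<phi>_W] by (simp add: adjacent_def)
    qed
  qed
  then show ?thesis using \<phi> R W unfolding contains_copy_def by blast
qed

definition common_neighbours :: "('a \<Rightarrow> 'a \<Rightarrow> bool) \<Rightarrow> 'a set \<Rightarrow> 'a set \<Rightarrow> 'a set" where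
  "common_neighbours adj R V = {j \<in> V. \<forall>v\<in>R. adj v j}"

lemma near_common_neighbours_pigeonhole:
  assumes "finite V" "finite Q" "Q \<noteq> {}"
  obtains u where "u \<in> Q" "card (near_common_neighbours adj Q V)
    \<le> card (common_neighbours adj (Q - {u}) V) * card Q"
proof -
  have "\<exists>u\<in>Q. {v \<in> Q. \<not> adj v j} \<subseteq> {u}" if "j \<in> near_common_neighbours adj Q V" for j
  proof (cases "{v \<in> Q. \<not> adj v j} = {}")
    case False
    then obtain u where "u \<in> {v \<in> Q. \<not> adj v j}" by blast
    moreover have "\<forall>a\<in>{v \<in> Q. \<not> adj v j}. \<forall>b\<in>{v \<in> Q. \<not> adj v j}. a = b"
      using that \<open>finite Q\<close>
      by (subst card_le_Suc0_iff_eq[symmetric]) (auto simp: near_common_neighbours_def)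
    ultimately show ?thesis by blast
  qed (use \<open>Q \<noteq> {}\<close> in auto)
  then obtain f where f: "\<And>j. j \<in> near_common_neighbours adj Q V \<Longrightarrow>
      f j \<in> Q \<and> {v \<in> Q. \<not> adj v j} \<subseteq> {f j}"
    by metis
  have "finite (near_common_neighbours adj Q V)"
    using \<open>finite V\<close> by (simp add: near_common_neighbours_def)
  then obtain u where "u \<in> Q" and fibre_ge: "card (near_common_neighbours adj Q V)
      \<le> card (f -` {u} \<inter> near_common_neighbours adj Q V) * card Q"
    using pigeonhole_card[of f "near_common_neighbours adj Q V" Q] f assms(2,3) by blast
  have "f -` {u} \<inter> near_common_neighbours adj Q V \<subseteq> common_neighbours adj (Q - {u}) V"
    using f by (auto simp: near_common_neighbours_def common_neighbours_def)
  then have "card (f -` {u} \<inter> near_common_neighbours adj Q V)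
      \<le> card (common_neighbours adj (Q - {u}) V)"
    using \<open>finite V\<close> by (intro card_mono) (auto simp: common_neighbours_def)
  with fibre_ge have "card (near_common_neighbours adj Q V)
      \<le> card (common_neighbours adj (Q - {u}) V) * card Q"
    by (meson le_trans mult_le_mono1)
  with \<open>u \<in> Q\<close> show thesis by (rule that)
qed

lemma book_of_near_common_neighbours:
  assumes G: "simple_graph n E" and Q: "Q \<subseteq> {..<n}" "card Q = r + 1" "pairwise (adjacent E) Q"
  obtains k where "contains_book n E r k"
    "card (near_common_neighbours (adjacent E) Q {..<n}) \<le> k * (r + 1)"
proof -
  have "finite Q" "Q \<noteq> {}" using Q by (auto intro: finite_subset)
  then obtain u where "u \<in> Q" and pages_ge: "card (near_common_neighbours (adjacent E) Q {..<n})
      \<le> card (common_neighbours (adjacent E) (Q - {u}) {..<n}) * card Q"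
    by (rule near_common_neighbours_pigeonhole[OF finite_lessThan])
  have "contains_book n E r (card (common_neighbours (adjacent E) (Q - {u}) {..<n}))"
  proof (rule contains_bookI)
    show "pairwise (adjacent E) (Q - {u})" using Q(3) by (rule pairwise_subset) auto
    show "(Q - {u}) \<inter> common_neighbours (adjacent E) (Q - {u}) {..<n} = {}"
      using irreflp_adjacent[OF G] by (auto simp: common_neighbours_def irreflp_def)
  qed (use Q \<open>u \<in> Q\<close> \<open>finite Q\<close> in \<open>auto simp: common_neighbours_def\<close>)
  with pages_ge show thesis using Q(2) that by simp
qed

text \<open>Below the density \<open>1 - 1/r\<close>, so that a subset with this minimum degree ratio exists, but close
  enough to it for the normalised degree sum of an \<open>(r+1)\<close>-clique to exceed \<open>r - 1\<close>.\<close>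

definition degree_ratio :: "nat \<Rightarrow> real" where
  "degree_ratio r = (1 - 1 / real r) * (1 - 1 / (4 * real r))"

lemma degree_ratio_bounds:
  assumes "r \<ge> 2"
  shows "0 \<le> degree_ratio r" "degree_ratio r < 1 - 1 / real r"
    "real r - 1 < degree_ratio r * (real r + 1 / 2)"
proof -
  have factor_bounds: "0 < 1 - 1 / real r" "0 < 1 / (4 * real r)" "1 / (4 * real r) \<le> 1"
    using assms by (auto simp: field_simps)
  show "0 \<le> degree_ratio r" using factor_bounds by (simp add: degree_ratio_def)
  show "degree_ratio r < 1 - 1 / real r"
    unfolding degree_ratio_def
    using mult_strict_left_mono[of "1 - 1 / (4 * real r)" 1 "1 - 1 / real r"] factor_bounds by simp
  have "degree_ratio r * (real r + 1 / 2) - (real r - 1) =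
      (real r - 1) * (2 * real r - 1) / (8 * (real r)\<^sup>2)"
    using assms by (simp add: degree_ratio_def divide_simps power2_eq_square) (simp add: algebra_simps)
  also have "\<dots> > 0" using assms by (intro divide_pos_pos mult_pos_pos) auto
  finally show "real r - 1 < degree_ratio r * (real r + 1 / 2)" by simp
qed

definition book_const :: "nat \<Rightarrow> real" where
  "book_const r = near_neighbour_const (degree_ratio r) r / (real r + 1)"

lemma book_const_pos: "r \<ge> 2 \<Longrightarrow> book_const r > 0"
  using degree_ratio_bounds[of r] by (simp add: book_const_def near_neighbour_const_def)

theorem spectral_book:
  assumes "r \<ge> 2" and G: "simple_graph n E"
    and large: "(1 - 1 / real r) * (2 * real (card E)) < (largest_eigenvalue n E)\<^sup>2"
  shows "\<exists>k. book_const r * sqrt (real (card E)) \<le> real k \<and> contains_book n E r k"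
proof -
  have "n > 0" using G by (simp add: simple_graph_def)
  then obtain x :: "nat \<Rightarrow> real" where x_nonneg: "\<And>i. 0 \<le> x i" and unit: "(\<Sum>i<n. (x i)\<^sup>2) = 1"
    and eigenvalue_le: "\<bar>largest_eigenvalue n E\<bar> \<le> lagrangian (adjacent E) x {..<n}"
    using abs_largest_eigenvalue_le_lagrangian[of n E] by blast
  have "(largest_eigenvalue n E)\<^sup>2 \<le> (lagrangian (adjacent E) x {..<n})\<^sup>2"
    using eigenvalue_le by (simp flip: abs_le_square_iff)
  with large have "(1 - 1 / real r) * lagrangian (adjacent E) (\<lambda>_. 1) {..<n} <
      (lagrangian (adjacent E) x {..<n})\<^sup>2"
    by (simp add: lagrangian_one_eq_card_edges[OF G])
  then obtain Q where Q: "Q \<subseteq> {..<n}" "card Q = r + 1" "pairwise (adjacent E) Q"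
    and const_le: "near_neighbour_const (degree_ratio r) r * sqrt (2 * real (card E))
      \<le> real (card (near_common_neighbours (adjacent E) Q {..<n}))"
    unfolding lagrangian_one_eq_card_edges[OF G, symmetric]
    by (rule large_lagrangian_near_common_neighbours[OF finite_lessThan \<open>r \<ge> 2\<close> symp_adjacent
          irreflp_adjacent[OF G] x_nonneg unit])
      (use degree_ratio_bounds[OF \<open>r \<ge> 2\<close>] in auto)
  obtain k where "contains_book n E r k"
    and pages_ge: "card (near_common_neighbours (adjacent E) Q {..<n}) \<le> k * (r + 1)"
    using G Q by (rule book_of_near_common_neighbours)
  have "book_const r * (real r + 1) * sqrt (real (card E)) \<le>
      book_const r * (real r + 1) * sqrt (2 * real (card E))"
    using book_const_pos[OF \<open>r \<ge> 2\<close>] by (intro mult_left_mono) auto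
  also have "\<dots> \<le> real (card (near_common_neighbours (adjacent E) Q {..<n}))"
    using const_le by (simp add: book_const_def)
  also have "\<dots> \<le> real (k * (r + 1))" using pages_ge by (rule of_nat_mono)
  finally have "(real r + 1) * (book_const r * sqrt (real (card E))) \<le> (real r + 1) * real k"
    by (simp add: algebra_simps)
  then have "book_const r * sqrt (real (card E)) \<le> real k" by simp
  with \<open>contains_book n E r k\<close> show ?thesis by blast
qed

section \<open>Sharpness\<close>

lemma regular_graph_eigenvalue:
  assumes "n > 0" and regular: "\<And>i. i < n \<Longrightarrow> card {j. j < n \<and> {i, j} \<in> E} = d"
  shows "eigenvalue (adjacency_matrix n E) (real d)"
proof -
  let ?A = "adjacency_matrix n E" and ?v = "vec n (\<lambda>_. 1 :: real)"
  have "?A *\<^sub>v ?v = real d \<cdot>\<^sub>v ?v"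
  proof (rule eq_vecI)
    fix i assume "i < dim_vec (real d \<cdot>\<^sub>v ?v)"
    then have "i < n" by simp
    then have "(?A *\<^sub>v ?v) $ i = (\<Sum>j<n. if {i, j} \<in> E then 1 else 0)"
      by (simp add: adjacency_matrix_def scalar_prod_def lessThan_atLeast0)
    also have "\<dots> = real (card {j. j < n \<and> {i, j} \<in> E})"
      by (simp add: sum.If_cases Int_def)
    finally show "(?A *\<^sub>v ?v) $ i = (real d \<cdot>\<^sub>v ?v) $ i" using \<open>i < n\<close> regular by simp
  qed (simp add: adjacency_matrix_def)
  moreover have "?v \<noteq> 0\<^sub>v n"
  proof
    assume "?v = 0\<^sub>v n"
    then have "?v $ 0 = 0\<^sub>v n $ 0" by simp
    then show False using \<open>n > 0\<close> by simp
  qed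
  ultimately have "eigenvector ?A ?v (real d)"
    by (simp add: eigenvector_def adjacency_matrix_def)
  then show ?thesis by (auto simp: eigenvalue_def)
qed

lemma contains_copy_order_le:
  assumes "contains_copy n E p F"
  shows "p \<le> n"
proof -
  obtain f where "inj_on f {..<p}" "f ` {..<p} \<subseteq> {..<n}"
    using assms by (auto simp: contains_copy_def)
  then have "card {..<p} \<le> card {..<n}" by (intro card_inj_on_le) auto
  then show ?thesis by simp
qed

definition complete_edges :: "nat \<Rightarrow> nat set set" where
  "complete_edges n = {e. e \<subseteq> {..<n} \<and> card e = 2}"

lemma simple_graph_complete: "n > 0 \<Longrightarrow> simple_graph n (complete_edges n)"
  by (auto simp: simple_graph_def complete_edges_def)

lemma card_complete_edges: "card (complete_edges n) = n choose 2"
  unfolding complete_edges_def using n_subsets[of "{..<n}" 2] by simp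

lemma two_times_real_choose_two: "2 * real (n choose 2) = real n * (real n - 1)"
proof -
  have "even (n * (n - 1))" by (cases "even n") auto
  then have "2 * (n choose 2) = n * (n - 1)" by (simp add: choose_two)
  then have "2 * real (n choose 2) = real n * real (n - 1)" by (metis of_nat_mult of_nat_numeral)
  then show ?thesis by (cases n) auto
qed

lemma largest_eigenvalue_complete_ge:
  assumes "n > 0"
  shows "real n - 1 \<le> largest_eigenvalue n (complete_edges n)"
proof -
  have "card {j. j < n \<and> {i, j} \<in> complete_edges n} = n - 1" if "i < n" for i
  proof -
    have "{j. j < n \<and> {i, j} \<in> complete_edges n} = {..<n} - {i}"
      using that by (auto simp: complete_edges_def card_insert_if)
    then show ?thesis using that by simp
  qed
  with assms have "real (n - 1) \<le> largest_eigenvalue n (complete_edges n)"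
    by (intro eigenvalue_le_largest_eigenvalue regular_graph_eigenvalue)
  then show ?thesis using assms by simp
qed

lemma complete_graph_spectral:
  assumes "r > 0" "n > r"
  shows "(1 - 1 / real r) * (2 * real (n choose 2)) < (largest_eigenvalue n (complete_edges n))\<^sup>2"
proof -
  have "(1 - 1 / real r) * real n < real n - 1" using assms by (simp add: field_simps)
  then have "(1 - 1 / real r) * real n * (real n - 1) < (real n - 1) * (real n - 1)"
    using assms by (intro mult_strict_right_mono) auto
  then have "(1 - 1 / real r) * (2 * real (n choose 2)) < (real n - 1)\<^sup>2"
    unfolding two_times_real_choose_two by (simp add: power2_eq_square mult.assoc)
  also have "\<dots> \<le> (largest_eigenvalue n (complete_edges n))\<^sup>2"
    using largest_eigenvalue_complete_ge[of n] assms by (intro power_mono) auto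
  finally show ?thesis .
qed

lemma le_choose_two:
  assumes "n \<ge> 3"
  shows "n \<le> n choose 2"
proof -
  have "n * 2 \<le> n * (n - 1)" using assms by (intro mult_left_mono) auto
  then show ?thesis unfolding choose_two by linarith
qed

lemma le_two_sqrt_choose_two:
  assumes "n \<ge> 2"
  shows "real n \<le> 2 * sqrt (real (n choose 2))"
proof (rule power2_le_imp_le)
  have "real n * 2 \<le> real n * real n" using assms by (intro mult_left_mono) auto
  then show "(real n)\<^sup>2 \<le> (2 * sqrt (real (n choose 2)))\<^sup>2"
    using two_times_real_choose_two[of n]
    by (simp add: power_mult_distrib power2_eq_square algebra_simps)
qed simp

lemma complete_graph_extremal:
  assumes "r \<ge> 2" "n > r"
  shows "\<exists>n' E. simple_graph n' E \<and> card E = n choose 2 \<and>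
    (1 - 1 / real r) * (2 * real (n choose 2)) < (largest_eigenvalue n' E)\<^sup>2 \<and>
    \<not> (\<exists>k. 2 * sqrt (real (n choose 2)) < real k \<and> contains_book n' E r k)"
proof (intro exI conjI)
  show "simple_graph n (complete_edges n)" using assms by (intro simple_graph_complete) auto
  show "\<not> (\<exists>k. 2 * sqrt (real (n choose 2)) < real k \<and> contains_book n (complete_edges n) r k)"
    using le_two_sqrt_choose_two[of n] assms by (fastforce dest: contains_copy_order_le)
qed (use assms in \<open>auto simp: card_complete_edges intro: complete_graph_spectral\<close>)

theorem theorem1p4:
  fixes r :: nat
  assumes "r \<ge> 2"
  shows "(\<exists>c::real. c > 0 \<and>
            (\<forall>n E m. simple_graph n E \<and> card E = m \<and>
               (largest_eigenvalue n E)\<^sup>2 > (1 - 1 / real r) * (2 * real m) \<longrightarrow>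
               (\<exists>k::nat. real k \<ge> c * sqrt (real m) \<and> contains_book n E r k))) \<and>
         (\<exists>C::real. infinite {m::nat. \<exists>n E. simple_graph n E \<and> card E = m \<and>
               (largest_eigenvalue n E)\<^sup>2 > (1 - 1 / real r) * (2 * real m) \<and>
               \<not> (\<exists>k::nat. real k > C * sqrt (real m) \<and> contains_book n E r k)})"
proof (intro conjI exI)
  show "book_const r > 0" using assms by (rule book_const_pos)
  show "\<forall>n E m. simple_graph n E \<and> card E = m \<and>
      (largest_eigenvalue n E)\<^sup>2 > (1 - 1 / real r) * (2 * real m) \<longrightarrow>
      (\<exists>k::nat. real k \<ge> book_const r * sqrt (real m) \<and> contains_book n E r k)"
    using spectral_book[OF assms] by blast
  show "infinite {m::nat. \<exists>n E. simple_graph n E \<and> card E = m \<and>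
      (largest_eigenvalue n E)\<^sup>2 > (1 - 1 / real r) * (2 * real m) \<and>
      \<not> (\<exists>k::nat. real k > 2 * sqrt (real m) \<and> contains_book n E r k)}" (is "infinite ?S")
    unfolding infinite_nat_iff_unbounded_le
  proof
    fix M
    define n where "n = M + r + 1"
    then have "M \<le> n choose 2" using le_choose_two[of n] assms by linarith
    moreover have "n choose 2 \<in> ?S"
      using complete_graph_extremal[OF assms, of n] by (simp add: n_def)
    ultimately show "\<exists>m\<ge>M. m \<in> ?S" by blast
  qed
qed

end
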